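(* Let $N\in\mathbb N$. All lifts of $\overline{\Gamma_1(N)}\le \mathrm{PSL}_2(\mathbb Z)$ are congruence subgroups of $\mathrm{SL}_2(\mathbb Z)$ if and only if $N\le 4$.
   Context: $\Gamma_1(N)$ is the subgroup of $\mathrm{SL}_2(\mathbb Z)$ of matrices that modulo $N$ are upper triangular with both diagonal entries equal to $1$, and $\Gamma(M)$ is the subgroup of matrices congruent to the identity modulo $M$. For a subgroup $\Gamma\le \mathrm{SL}_2(\mathbb Z)$, $\overline\Gamma$ denotes its image in $\mathrm{PSL}_2(\mathbb Z)=\mathrm{SL}_2(\mathbb Z)/\{\pm 1\}$. A subgroup $\Gamma'$ of $\mathrm{SL}_2(\mathbb Z)$ (of finite index) is a lift of $\overline\Gamma$ if the image of $\Gamma'$ under the canonical homomorphism $\mathrm{SL}_2(\mathbb Z)\to\mathrm{PSL}_2(\mathbb Z)$ is equal to $\overline\Gamma$. A subgroup of $\mathrm{SL}_2(\mathbb Z)$ is a congruence subgroup if it contains $\Gamma(M)$ for some $M\in\mathbb N$. *)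

theory Defs
  imports "HOL-Analysis.Analysis" "HOL-Algebra.Coset" "HOL-Number_Theory.Cong"
begin

definition SL2Z :: "(int ^ 2 ^ 2) monoid" where
  "SL2Z = \<lparr>carrier = {A. det A = 1}, mult = (**), one = mat 1\<rparr>"

definition pm_one :: "(int ^ 2 ^ 2) set" where
  "pm_one = {mat 1, - mat 1}"

definition PSL2Z :: "(int ^ 2 ^ 2) set monoid" where
  "PSL2Z = SL2Z Mod pm_one"

definition proj_PSL2Z :: "int ^ 2 ^ 2 \<Rightarrow> (int ^ 2 ^ 2) set" where
  "proj_PSL2Z A = pm_one #>\<^bsub>SL2Z\<^esub> A"

definition Gamma1 :: "nat \<Rightarrow> (int ^ 2 ^ 2) set" where
  "Gamma1 N = {A \<in> carrier SL2Z.
     [A $ 1 $ 1 = 1] (mod int N) \<and> [A $ 2 $ 1 = 0] (mod int N) \<and> [A $ 2 $ 2 = 1] (mod int N)}"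

definition Gamma :: "nat \<Rightarrow> (int ^ 2 ^ 2) set" where
  "Gamma M = {A \<in> carrier SL2Z. \<forall>i j. [A $ i $ j = mat 1 $ i $ j] (mod int M)}"

(* The argument P is a subgroup of PSL2Z; being a lift includes having finite index. *)
definition is_lift :: "(int ^ 2 ^ 2) set \<Rightarrow> (int ^ 2 ^ 2) set set \<Rightarrow> bool" where
  "is_lift H P \<longleftrightarrow>
     subgroup H SL2Z \<and> finite (rcosets\<^bsub>SL2Z\<^esub> H) \<and> proj_PSL2Z ` H = P"

(* M must be positive: Gamma 0 is the trivial subgroup. *)
definition congruence_subgroup :: "(int ^ 2 ^ 2) set \<Rightarrow> bool" where
  "congruence_subgroup H \<longleftrightarrow> subgroup H SL2Z \<and> (\<exists>M\<ge>1. Gamma M \<subseteq> H)"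

lemma group_SL2Z: "group SL2Z"
proof (rule groupI)
  fix A assume "A \<in> carrier SL2Z"
  then have d: "A $ 1 $ 1 * A $ 2 $ 2 - A $ 1 $ 2 * A $ 2 $ 1 = 1"
    by (simp add: SL2Z_def det_2)
  define B :: "int ^ 2 ^ 2" where
    "B = vector [vector [A $ 2 $ 2, - A $ 1 $ 2], vector [- A $ 2 $ 1, A $ 1 $ 1]]"
  have "det B = 1"
    using d by (simp add: B_def det_2 algebra_simps)
  moreover have "B ** A = mat 1"
    using d by (simp add: B_def matrix_matrix_mult_def mat_def vec_eq_iff forall_2 sum_2 algebra_simps)
  ultimately show "\<exists>B\<in>carrier SL2Z. B \<otimes>\<^bsub>SL2Z\<^esub> A = \<one>\<^bsub>SL2Z\<^esub>"
    by (auto simp: SL2Z_def)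
qed (auto simp: SL2Z_def det_mul matrix_mul_assoc)

lemma normal_pm_one: "pm_one \<lhd> SL2Z"
proof -
  interpret group SL2Z by (rule group_SL2Z)
  have neg: "(- mat 1) ** A = - A" "A ** (- mat 1) = - A" for A :: "int ^ 2 ^ 2"
    by (simp_all add: matrix_matrix_mult_def mat_def vec_eq_iff forall_2 sum_2)
  have m1: "- mat 1 \<in> carrier SL2Z"
    by (simp add: SL2Z_def det_2 mat_def)
  have sq: "- mat 1 \<otimes>\<^bsub>SL2Z\<^esub> - mat 1 = \<one>\<^bsub>SL2Z\<^esub>"
    by (simp add: SL2Z_def neg)
  have sub: "subgroup pm_one SL2Z"
  proof (rule subgroupI)
    fix a assume "a \<in> pm_one"
    then show "inv\<^bsub>SL2Z\<^esub> a \<in> pm_one"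
      using inv_equality[OF sq m1 m1] inv_one by (auto simp: pm_one_def SL2Z_def)
  qed (use m1 in \<open>auto simp: pm_one_def SL2Z_def neg\<close>)
  show ?thesis
    by (rule normalI[OF sub]) (auto simp: r_coset_def l_coset_def pm_one_def SL2Z_def neg)
qed

lemma group_PSL2Z: "group PSL2Z"
  unfolding PSL2Z_def by (rule normal.factorgroup_is_group[OF normal_pm_one])

lemma proj_PSL2Z_hom: "proj_PSL2Z \<in> hom SL2Z PSL2Z"
  using normal.r_coset_hom_Mod[OF normal_pm_one]
  by (simp add: PSL2Z_def proj_PSL2Z_def[abs_def])

end

theory Submission imports Defs begin

text \<open>
  A lift containing \<open>-1\<close> contains \<open>\<Gamma>\<^sub>1(N)\<close>; this covers \<open>N \<le> 2\<close>, where \<open>\<Gamma>\<^sub>1(N)\<close> has an element of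
  order four. For \<open>N = 3, 4\<close> the group \<open>\<Gamma>\<^sub>1(N)\<close> is generated by the two matrices \<open>(1 1; 0 1)\<close> and
  \<open>(1 0; N 1)\<close>, so a lift without \<open>-1\<close> is the twist \<open>{\<epsilon>(A) A}\<close> by a sign character \<open>\<epsilon>\<close> that is determined
  by its values on them, and every possible \<open>\<epsilon>\<close> is given by a formula modulo \<open>6\<close> or \<open>8\<close>.

  For \<open>N \<ge> 5\<close> a sign character comes from the Farey tessellation: mark one \<open>\<Gamma>\<^sub>1(N)\<close>-orbit of edges
  and let \<open>\<epsilon>(A)\<close> be the parity of the number of marked edges that separate the base triangle from its
  image under \<open>A\<close>. On a parabolic element this counts the marked edges at the fixed cusp. Marking an
  edge joining cusps of denominators \<open>1\<close> and \<open>2\<close> modulo \<open>N\<close>, the parity is odd at denominator \<open>1\<close> and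
  even at a suitable odd denominator \<open>c\<close> (\<open>3\<close>, or \<open>5\<close> if \<open>N = 5\<close>), whereas a character trivial on some
  \<open>\<Gamma>(M)\<close> would have to take the same value at both.
\<close>

section \<open>Two-by-two integer matrices, signs and membership criteria\<close>

definition m2 :: "int \<Rightarrow> int \<Rightarrow> int \<Rightarrow> int \<Rightarrow> int ^ 2 ^ 2" where
  "m2 a b c d = vector [vector [a, b], vector [c, d]]"

lemma m2_nth [simp]:
  "m2 a b c d $ 1 $ 1 = a" "m2 a b c d $ 1 $ 2 = b"
  "m2 a b c d $ 2 $ 1 = c" "m2 a b c d $ 2 $ 2 = d"
  by (simp_all add: m2_def)

lemma m2_eq_iff [simp]: "m2 a b c d = m2 a' b' c' d' \<longleftrightarrow> a = a' \<and> b = b' \<and> c = c' \<and> d = d'"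
  by (auto simp: vec_eq_iff forall_2)

lemma m2_eta: "m2 (A $ 1 $ 1) (A $ 1 $ 2) (A $ 2 $ 1) (A $ 2 $ 2) = A"
  by (simp add: vec_eq_iff forall_2)

lemma m2_mult [simp]:
  "m2 a b c d ** m2 a' b' c' d' = m2 (a*a' + b*c') (a*b' + b*d') (c*a' + d*c') (c*b' + d*d')"
  by (simp add: vec_eq_iff forall_2 matrix_matrix_mult_def sum_2)

lemma m2_uminus [simp]: "- m2 a b c d = m2 (-a) (-b) (-c) (-d)"
  by (simp add: vec_eq_iff forall_2)

lemma mat_1_m2: "mat 1 = m2 1 0 0 1"
  by (simp add: vec_eq_iff forall_2 mat_def)

lemma mult_SL2Z [simp]: "A \<otimes>\<^bsub>SL2Z\<^esub> B = A ** B"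
  by (simp add: SL2Z_def)

lemma one_SL2Z [simp]: "\<one>\<^bsub>SL2Z\<^esub> = m2 1 0 0 1"
  by (simp add: SL2Z_def mat_1_m2)

lemma m2_in_SL2Z [simp]: "m2 a b c d \<in> carrier SL2Z \<longleftrightarrow> a * d - b * c = 1"
  by (simp add: SL2Z_def det_2)

interpretation SL2Z: group SL2Z
  by (rule group_SL2Z)

lemma SL2Z_cases:
  assumes "A \<in> carrier SL2Z"
  obtains a b c d where "A = m2 a b c d" "a * d - b * c = 1"
  using assms m2_eta[of A] m2_in_SL2Z by metis

lemma inv_m2:
  assumes "a * d - b * c = 1"
  shows "inv\<^bsub>SL2Z\<^esub> (m2 a b c d) = m2 d (-b) (-c) a"
  by (rule SL2Z.inv_equality) (use assms in \<open>simp_all add: algebra_simps\<close>)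

lemma neg_in_SL2Z [simp]: "- A \<in> carrier SL2Z \<longleftrightarrow> A \<in> carrier SL2Z"
  by (simp add: SL2Z_def det_2)

lemma neg_mult_left: "(- A) ** B = - (A ** B)" for A B :: "int ^ 2 ^ 2"
  by (simp add: vec_eq_iff forall_2 matrix_matrix_mult_def sum_2)

lemma neg_mult_right: "A ** (- B) = - (A ** B)" for A B :: "int ^ 2 ^ 2"
  by (simp add: vec_eq_iff forall_2 matrix_matrix_mult_def sum_2)

lemma inv_neg:
  assumes "A \<in> carrier SL2Z"
  shows "inv\<^bsub>SL2Z\<^esub> (- A) = - (inv\<^bsub>SL2Z\<^esub> A)"
  using assms by (elim SL2Z_cases) (simp add: inv_m2)

lemma proj_PSL2Z_eq: "proj_PSL2Z A = {A, - A}"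
  by (auto simp: proj_PSL2Z_def pm_one_def r_coset_def neg_mult_left)

lemma m2_in_Gamma1:
  "m2 a b c d \<in> Gamma1 N \<longleftrightarrow>
     a * d - b * c = 1 \<and> [a = 1] (mod int N) \<and> [c = 0] (mod int N) \<and> [d = 1] (mod int N)"
  by (simp add: Gamma1_def)

lemma m2_in_Gamma:
  "m2 a b c d \<in> Gamma M \<longleftrightarrow> a * d - b * c = 1 \<and> [a = 1] (mod int M) \<and>
     [b = 0] (mod int M) \<and> [c = 0] (mod int M) \<and> [d = 1] (mod int M)"
  by (simp add: Gamma_def forall_2 mat_1_m2 conj_assoc)

lemma Gamma1_carrier: "A \<in> Gamma1 N \<Longrightarrow> A \<in> carrier SL2Z"
  by (simp add: Gamma1_def)

lemma Gamma_carrier: "A \<in> Gamma N \<Longrightarrow> A \<in> carrier SL2Z"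
  by (simp add: Gamma_def)

lemma Gamma_subset_Gamma1:
  assumes "N dvd M"
  shows "Gamma M \<subseteq> Gamma1 N"
proof
  fix A assume "A \<in> Gamma M"
  moreover from this obtain a b c d where "A = m2 a b c d"
    using Gamma_carrier SL2Z_cases by metis
  moreover have "int N dvd int M"
    using assms by simp
  ultimately show "A \<in> Gamma1 N"
    by (auto simp: m2_in_Gamma m2_in_Gamma1 intro: cong_dvd_modulus)
qed

lemma subgroup_Gamma1: "subgroup (Gamma1 N) SL2Z"
proof (rule SL2Z.subgroupI)
  show "Gamma1 N \<subseteq> carrier SL2Z"
    by (auto simp: Gamma1_def)
  have "m2 1 0 0 1 \<in> Gamma1 N"
    by (simp add: m2_in_Gamma1)
  then show "Gamma1 N \<noteq> {}"
    by blast
next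
  fix A assume A: "A \<in> Gamma1 N"
  then obtain a b c d where Ae: "A = m2 a b c d" "a * d - b * c = 1"
    using Gamma1_carrier SL2Z_cases by metis
  have "[- c = - 0] (mod int N)"
    using A by (simp only: cong_minus_minus_iff Ae m2_in_Gamma1)
  with A show "inv\<^bsub>SL2Z\<^esub> A \<in> Gamma1 N"
    by (simp add: Ae inv_m2 m2_in_Gamma1 algebra_simps)
next
  fix A B assume A: "A \<in> Gamma1 N" and B: "B \<in> Gamma1 N"
  obtain a b c d where Ae: "A = m2 a b c d" using A Gamma1_carrier SL2Z_cases by metis
  obtain a' b' c' d' where Be: "B = m2 a' b' c' d'" using B Gamma1_carrier SL2Z_cases by metis
  have AB: "A ** B \<in> carrier SL2Z"
    using SL2Z.m_closed[of A B] A B Gamma1_carrier by auto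
  have "[a * a' + b * c' = 1 * 1 + b * 0] (mod int N)" "[c * a' + d * c' = 0 * 1 + 1 * 0] (mod int N)"
       "[c * b' + d * d' = 0 * b' + 1 * 1] (mod int N)"
    using A B by (intro cong_add cong_mult; simp add: Ae Be m2_in_Gamma1)+
  with AB show "A \<otimes>\<^bsub>SL2Z\<^esub> B \<in> Gamma1 N"
    by (simp add: Ae Be m2_in_Gamma1)
qed

subsection \<open>Levels at most four\<close>

abbreviation up :: "int \<Rightarrow> int ^ 2 ^ 2" where "up k \<equiv> m2 1 k 0 1"
abbreviation lo :: "int \<Rightarrow> int ^ 2 ^ 2" where "lo k \<equiv> m2 1 0 k 1"

section \<open>Two generators for \<open>Gamma1 N\<close> when \<open>N\<close> is 3 or 4\<close>

lemma subgroup_mult: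
  assumes "subgroup K SL2Z" "A \<in> K" "B \<in> K"
  shows "A ** B \<in> K"
  using subgroup.m_closed[OF assms] by simp

lemma subgroup_div:
  assumes "subgroup K SL2Z" "A \<in> K" "m2 a b c d \<in> K"
  shows "A ** m2 d (-b) (-c) a \<in> K"
proof -
  have "a * d - b * c = 1"
    using subgroup.mem_carrier[OF assms(1,3)] by simp
  then show ?thesis
    using subgroup_mult[OF assms(1,2) subgroup.m_inv_closed[OF assms(1,3)]] by (simp add: inv_m2)
qed

lemma subgroup_up:
  assumes K: "subgroup K SL2Z" and n: "up n \<in> K"
  shows "up (n * k) \<in> K"
proof (induction k rule: int_induct[where k = 0])
  case base
  show ?case using subgroup.one_closed[OF K] by simp
next
  case (step1 i)
  show ?case using subgroup_mult[OF K step1(2) n] by (simp add: algebra_simps)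
next
  case (step2 i)
  show ?case using subgroup_div[OF K step2(2) n] by (simp add: algebra_simps)
qed

lemma subgroup_lo:
  assumes K: "subgroup K SL2Z" and n: "lo n \<in> K"
  shows "lo (n * k) \<in> K"
proof (induction k rule: int_induct[where k = 0])
  case base
  show ?case using subgroup.one_closed[OF K] by simp
next
  case (step1 i)
  show ?case using subgroup_mult[OF K step1(2) n] by (simp add: algebra_simps)
next
  case (step2 i)
  show ?case using subgroup_div[OF K step2(2) n] by (simp add: algebra_simps)
qed

lemma balanced_remainder:
  fixes x y :: int
  assumes "y \<noteq> 0"
  shows "\<exists>k. 2 * \<bar>x + k * y\<bar> \<le> \<bar>y\<bar>"
proof -
  have r: "x = y * (x div y) + x mod y"
    by simp
  have b: "\<bar>x mod y\<bar> < \<bar>y\<bar>"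
    using assms by (rule abs_mod_less)
  consider "2 * \<bar>x mod y\<bar> \<le> \<bar>y\<bar>" | "2 * \<bar>x mod y - y\<bar> \<le> \<bar>y\<bar>"
    using b assms pos_mod_sign[of y x] neg_mod_sign[of y x]
    by (cases "y > 0"; force)
  then show ?thesis
  proof cases
    case 1
    have "x + (- (x div y)) * y = x mod y"
      using r by (simp add: algebra_simps)
    with 1 show ?thesis by metis
  next
    case 2
    have "x + (- (x div y) - 1) * y = x mod y - y"
      using r by (simp add: algebra_simps)
    with 2 show ?thesis by metis
  qed
qed

text \<open>The Euclidean algorithm on the bottom row, with remainders of least absolute value; each
  round strictly decreases the lower left entry because \<open>N \<le> 4\<close>.\<close>

lemma Gamma1_generated:
  assumes K: "subgroup K SL2Z" and up1: "up 1 \<in> K" and loN: "lo (int N) \<in> K"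
    and N: "N = 3 \<or> N = 4"
  shows "Gamma1 N \<subseteq> K"
proof
  have "m2 a b c d \<in> Gamma1 N \<longrightarrow> m2 a b c d \<in> K" for a b c d
  proof (induction "nat \<bar>c\<bar>" arbitrary: a b c d rule: less_induct)
    case less
    show ?case
    proof
      assume G: "m2 a b c d \<in> Gamma1 N"
      show "m2 a b c d \<in> K"
      proof (cases "c = 0")
        case True
        have "a * d = 1" "[a = 1] (mod int N)"
          using G True by (auto simp: m2_in_Gamma1)
        then have "a = 1 \<and> d = 1"
          using N by (auto simp: zmult_eq_1_iff cong_iff_dvd_diff)
        then show ?thesis
          using subgroup_up[OF K up1, of b] True by simp
      next
        case False
        obtain k where k: "2 * \<bar>d + k * c\<bar> \<le> \<bar>c\<bar>"
          using balanced_remainder[OF False] by blast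
        define d' where "d' = d + k * c"
        have cN: "int N dvd c" and dN: "int N dvd d - 1"
          using G by (auto simp: m2_in_Gamma1 cong_iff_dvd_diff)
        then have d'N: "int N dvd d' - 1"
          using dvd_add[of "int N" "d - 1" "k * c"] by (simp add: d'_def algebra_simps)
        have "d' \<noteq> 0"
          using d'N N by auto
        then have "int N * d' \<noteq> 0"
          using N by auto
        then obtain j where j: "2 * \<bar>c + j * (int N * d')\<bar> \<le> \<bar>int N * d'\<bar>"
          using balanced_remainder by blast
        define c' where "c' = c + j * (int N * d')"
        have k': "2 * \<bar>d'\<bar> \<le> \<bar>c\<bar>"
          using k by (simp add: d'_def)
        have j': "2 * \<bar>c'\<bar> \<le> int N * \<bar>d'\<bar>"
          using j by (simp add: c'_def abs_mult)
        \<comment> \<open>The two bounds give 4 |c'| <= N |c|, which suffices for N = 3. For N = 4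
          equality would need 2 |d'| = |c|; as 4 divides \<open>c\<close>, this makes
          \<open>d'\<close> even, although it is 1 modulo 4.\<close>
        have "\<bar>c'\<bar> < \<bar>c\<bar>"
          using N
        proof
          assume "N = 3"
          then show ?thesis
            using k' j' False by simp
        next
          assume N4: "N = 4"
          have "2 * \<bar>d'\<bar> \<noteq> \<bar>c\<bar>"
            using cN d'N unfolding N4 by presburger
          then show ?thesis
            using k' j' N4 by simp
        qed
        then have less_c: "nat \<bar>c'\<bar> < nat \<bar>c\<bar>"
          by simp
        \<comment> \<open>Right multiplication by \<open>up k\<close> turns the bottom row (c, d)
          into (c, d'), and \<open>lo (int N * j)\<close> turns that into (c', d').\<close>
        define R where "R = up k ** lo (int N * j)"
        have RK: "R \<in> K"
          unfolding R_def using subgroup_mult[OF K subgroup_up[OF K up1, of k] subgroup_lo[OF K loN, of j]] by simp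
        have RG: "R \<in> Gamma1 N"
          unfolding R_def by (rule subgroup_mult[OF subgroup_Gamma1]) (simp_all add: m2_in_Gamma1 cong_0_iff)
        obtain r1 r2 r3 r4 where Re: "R = m2 r1 r2 r3 r4"
          unfolding R_def by simp
        have bot: "(m2 a b c d ** R) $ 2 $ 1 = c'"
          by (simp add: R_def c'_def d'_def algebra_simps)
        have "m2 a b c d ** R \<in> Gamma1 N"
          by (rule subgroup_mult[OF subgroup_Gamma1 G RG])
        then have "m2 a b c d ** R \<in> K"
          using less[rule_format, OF less_c] bot m2_eta[of "m2 a b c d ** R"] by metis
        from subgroup_mult[OF K this subgroup.m_inv_closed[OF K RK]]
        have "m2 a b c d \<otimes>\<^bsub>SL2Z\<^esub> R \<otimes>\<^bsub>SL2Z\<^esub> inv\<^bsub>SL2Z\<^esub> R \<in> K"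
          by simp
        then show ?thesis
          using G Gamma1_carrier RK subgroup.mem_carrier[OF K] SL2Z.m_assoc SL2Z.r_inv SL2Z.r_one
            SL2Z.inv_closed by metis
      qed
    qed
  qed
  then show "A \<in> K" if "A \<in> Gamma1 N" for A
    using that m2_eta[of A] by metis
qed

section \<open>Congruence of the lifts at levels one to four\<close>

lemma lift_mem:
  assumes "is_lift H (proj_PSL2Z ` Gamma1 N)" "A \<in> Gamma1 N"
  shows "A \<in> H \<or> - A \<in> H"
proof -
  have "proj_PSL2Z A \<in> proj_PSL2Z ` H"
    using assms by (auto simp: is_lift_def)
  then show ?thesis
    by (auto simp: proj_PSL2Z_eq doubleton_eq_iff)
qed

lemma congruence_lift_if_neg_one:
  assumes L: "is_lift H (proj_PSL2Z ` Gamma1 N)" and m1: "- mat 1 \<in> H" and "N \<ge> 1"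
  shows "congruence_subgroup H"
proof -
  have H: "subgroup H SL2Z"
    using L by (simp add: is_lift_def)
  have "Gamma N \<subseteq> H"
  proof
    fix A assume "A \<in> Gamma N"
    then have "A \<in> Gamma1 N"
      using Gamma_subset_Gamma1[of N N] by auto
    moreover have "A \<in> H" if "- A \<in> H"
      using subgroup_mult[OF H m1 that] by (simp add: neg_mult_left)
    ultimately show "A \<in> H"
      using lift_mem[OF L] by blast
  qed
  with H \<open>N \<ge> 1\<close> show ?thesis
    by (auto simp: congruence_subgroup_def)
qed

text \<open>One of \<open>A\<close> and \<open>- A\<close> lies in \<open>H\<close>, and both have
  square -1.\<close>

lemma congruence_lift_if_order_four:
  assumes L: "is_lift H (proj_PSL2Z ` Gamma1 N)" and A: "A \<in> Gamma1 N" "A ** A = - mat 1"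
    and "N \<ge> 1"
  shows "congruence_subgroup H"
proof (rule congruence_lift_if_neg_one[OF L _ \<open>N \<ge> 1\<close>])
  have "subgroup H SL2Z"
    using L by (simp add: is_lift_def)
  then show "- mat 1 \<in> H"
    using lift_mem[OF L A(1)] subgroup_mult[of H A A] subgroup_mult[of H "- A" "- A"] A(2)
    by (auto simp: neg_mult_left neg_mult_right)
qed

text \<open>\<open>True\<close> encodes the sign -1. The matrices whose signed version lies in
  \<open>H\<close> form a subgroup \<open>K\<close> containing both generators, hence all of
  \<open>Gamma1 N\<close>. On \<open>Gamma M\<close> the sign is trivial, so there membership in
  \<open>K\<close> is membership in \<open>H\<close>.\<close>

lemma congruence_lift_if_sign:
  assumes H: "subgroup H SL2Z" and N: "N = 3 \<or> N = 4"
    and hom: "\<And>A B. A \<in> Gamma1 N \<Longrightarrow> B \<in> Gamma1 N \<Longrightarrow> \<epsilon> (A ** B) = (\<epsilon> A \<noteq> \<epsilon> B)"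
    and up1: "if \<epsilon> (up 1) then - up 1 \<in> H else up 1 \<in> H"
    and loN: "if \<epsilon> (lo (int N)) then - lo (int N) \<in> H else lo (int N) \<in> H"
    and triv: "\<And>A. A \<in> Gamma M \<Longrightarrow> \<not> \<epsilon> A" and M: "N dvd M" "M \<ge> 1"
  shows "congruence_subgroup H"
proof -
  define K where "K = {A \<in> Gamma1 N. if \<epsilon> A then - A \<in> H else A \<in> H}"
  have one: "m2 1 0 0 1 \<in> Gamma1 N"
    by (simp add: m2_in_Gamma1)
  have e1: "\<not> \<epsilon> (m2 1 0 0 1)"
    using hom[OF one one] by simp
  have "subgroup K SL2Z"
  proof (rule SL2Z.subgroupI)
    show "K \<subseteq> carrier SL2Z"
      by (auto simp: K_def Gamma1_carrier)
    show "K \<noteq> {}"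
      using one e1 subgroup.one_closed[OF H] by (auto simp: K_def)
  next
    fix A assume A: "A \<in> K"
    then have A1: "A \<in> Gamma1 N" "inv\<^bsub>SL2Z\<^esub> A \<in> Gamma1 N"
      using subgroup.m_inv_closed[OF subgroup_Gamma1] by (auto simp: K_def)
    have "A ** inv\<^bsub>SL2Z\<^esub> A = m2 1 0 0 1"
      using SL2Z.r_inv[OF Gamma1_carrier[OF A1(1)]] by simp
    then have "\<epsilon> (inv\<^bsub>SL2Z\<^esub> A) = \<epsilon> A"
      using hom[OF A1] e1 by simp
    then show "inv\<^bsub>SL2Z\<^esub> A \<in> K"
      using A A1 subgroup.m_inv_closed[OF H] inv_neg[OF Gamma1_carrier[OF A1(1)]]
      unfolding K_def by (auto split: if_splits) metis
  next
    fix A B assume "A \<in> K" "B \<in> K"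
    then show "A \<otimes>\<^bsub>SL2Z\<^esub> B \<in> K"
      using hom[of A B] subgroup_mult[OF subgroup_Gamma1, of A N B] subgroup_mult[OF H, of A B]
        subgroup_mult[OF H, of "-A" B] subgroup_mult[OF H, of A "-B"] subgroup_mult[OF H, of "-A" "-B"]
      by (auto simp: K_def neg_mult_left neg_mult_right split: if_splits)
  qed
  moreover have "up 1 \<in> K" "lo (int N) \<in> K"
    using up1 loN by (auto simp: K_def m2_in_Gamma1 cong_0_iff)
  ultimately have "Gamma1 N \<subseteq> K"
    using N by (rule Gamma1_generated)
  then have "Gamma M \<subseteq> H"
    using Gamma_subset_Gamma1[OF M(1)] triv by (force simp: K_def)
  then show ?thesis
    using H M(2) by (auto simp: congruence_subgroup_def)
qed

lemma congruence_lift_level_3: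
  assumes L: "is_lift H (proj_PSL2Z ` Gamma1 3)"
  shows "congruence_subgroup H"
proof (cases "- mat 1 \<in> H")
  case True
  with L show ?thesis by (rule congruence_lift_if_neg_one) simp
next
  case False
  have H: "subgroup H SL2Z"
    using L by (simp add: is_lift_def)
  have u: "up 1 \<in> H \<or> - up 1 \<in> H" and l: "lo 3 \<in> H \<or> - lo 3 \<in> H"
    by (rule lift_mem[OF L], simp add: m2_in_Gamma1 cong_def)+
  text \<open>\<^term>\<open>up 1 ** lo (-3)\<close> has order three, so its negative cannot lie in \<open>H\<close>, which does not contain \<open>-1\<close>.\<close>
  have W: "m2 2 (-1) 3 (-1) \<notin> H"
  proof
    assume w: "m2 2 (-1) 3 (-1) \<in> H"
    show False
      using subgroup_mult[OF H subgroup_mult[OF H w w] w] False by (simp add: mat_1_m2)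
  qed
  have "\<not> (up 1 \<in> H \<and> - lo 3 \<in> H)" "\<not> (- up 1 \<in> H \<and> lo 3 \<in> H)"
    using W subgroup_div[OF H, of "up 1" "-1" 0 "-3" "-1"] subgroup_div[OF H, of "- up 1" 1 0 3 1]
    by auto
  then have same: "up 1 \<in> H \<and> lo 3 \<in> H \<and> - up 1 \<notin> H \<or> - up 1 \<in> H \<and> - lo 3 \<in> H"
    using u l by blast
  \<comment> \<open>Modulo 2 the polynomial is the sign character of SL_2(Z/2), the symmetric group
    on three letters. It is odd on both generators, as \<open>same\<close> requires, and level 6
    makes it trivial.\<close>
  define \<epsilon> where "\<epsilon> A \<longleftrightarrow> - up 1 \<in> H \<and>
    odd (A $ 1 $ 1 * A $ 1 $ 2 + A $ 1 $ 2 * A $ 2 $ 1 + A $ 2 $ 1 * A $ 2 $ 2)" for A :: "int ^ 2 ^ 2"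
  show ?thesis
  proof (rule congruence_lift_if_sign[where N = 3 and \<epsilon> = \<epsilon> and M = 6])
    fix A B assume "A \<in> Gamma1 3" "B \<in> Gamma1 3"
    then obtain a b c d a' b' c' d' where AB: "A = m2 a b c d" "a * d - b * c = 1" "B = m2 a' b' c' d'" "a' * d' - b' * c' = 1"
      using Gamma1_carrier SL2Z_cases by metis
    have "odd (a * d - b * c)" "odd (a' * d' - b' * c')"
      using AB by simp_all
    then show "\<epsilon> (A ** B) = (\<epsilon> A \<noteq> \<epsilon> B)"
      unfolding \<epsilon>_def AB(1,3) by auto
  next
    fix A assume A: "A \<in> Gamma 6"
    then obtain a b c d where Ae: "A = m2 a b c d"
      using Gamma_carrier SL2Z_cases by metis
    have "6 dvd b" "6 dvd c"
      using A by (auto simp: Ae m2_in_Gamma cong_0_iff)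
    then have "even b" "even c"
      by presburger+
    then show "\<not> \<epsilon> A"
      by (simp add: \<epsilon>_def Ae)
  qed (use H same in \<open>auto simp: \<epsilon>_def\<close>)
qed

lemma congruence_lift_level_4:
  assumes L: "is_lift H (proj_PSL2Z ` Gamma1 4)"
  shows "congruence_subgroup H"
proof (cases "- mat 1 \<in> H")
  case True
  with L show ?thesis by (rule congruence_lift_if_neg_one) simp
next
  case False
  have H: "subgroup H SL2Z"
    using L by (simp add: is_lift_def)
  have u: "up 1 \<in> H \<or> - up 1 \<in> H" and l: "lo 4 \<in> H \<or> - lo 4 \<in> H"
    by (rule lift_mem[OF L], simp add: m2_in_Gamma1 cong_def)+
  \<comment> \<open>The signs of the two generators are prescribed independently: the parity of the
    upper right entry sees only \<open>up 1\<close>, that of a quarter of the lower left entry only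
    \<open>lo 4\<close>. Both are additive because the diagonal entries are odd.\<close>
  define \<epsilon> where "\<epsilon> A \<longleftrightarrow> (- up 1 \<in> H \<and> odd (A $ 1 $ 2)) \<noteq> (- lo 4 \<in> H \<and> \<not> 8 dvd A $ 2 $ 1)"
    for A :: "int ^ 2 ^ 2"
  show ?thesis
  proof (rule congruence_lift_if_sign[where N = 4 and \<epsilon> = \<epsilon> and M = 8])
    fix A B assume AB: "A \<in> Gamma1 4" "B \<in> Gamma1 4"
    then obtain a b c d a' b' c' d' where e: "A = m2 a b c d" "B = m2 a' b' c' d'"
      using Gamma1_carrier SL2Z_cases by metis
    obtain x y where xy: "c = 4 * x" "c' = 4 * y"
      using AB unfolding e by (auto simp: m2_in_Gamma1 cong_0_iff dvd_def)
    have "4 dvd a - 1" "4 dvd a' - 1" "4 dvd d - 1" "4 dvd d' - 1"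
      using AB unfolding e by (auto simp: m2_in_Gamma1 cong_iff_dvd_diff)
    then have odds: "odd a" "odd a'" "odd d" "odd d'"
      by presburger+
    have eight: "8 dvd 4 * z \<longleftrightarrow> even z" for z :: int
      by presburger
    have "c * a' + d * c' = 4 * (x * a' + d * y)"
      by (simp add: xy algebra_simps)
    then have "8 dvd c * a' + d * c' \<longleftrightarrow> even (x * a' + d * y)"
      using eight by metis
    then show "\<epsilon> (A ** B) = (\<epsilon> A \<noteq> \<epsilon> B)"
      using odds by (auto simp: \<epsilon>_def e xy eight)
  next
    fix A assume A: "A \<in> Gamma 8"
    then obtain a b c d where Ae: "A = m2 a b c d"
      using Gamma_carrier SL2Z_cases by metis
    have "8 dvd b" "8 dvd c"
      using A by (auto simp: Ae m2_in_Gamma cong_0_iff)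
    moreover from this have "even b"
      by presburger
    ultimately show "\<not> \<epsilon> A"
      by (simp add: \<epsilon>_def Ae)
  qed (use H u l in \<open>auto simp: \<epsilon>_def\<close>)
qed

lemma congruence_lift_level_le_4:
  assumes "N \<ge> 1" "N \<le> 4" and L: "is_lift H (proj_PSL2Z ` Gamma1 N)"
  shows "congruence_subgroup H"
proof -
  consider "N = 1" | "N = 2" | "N = 3" | "N = 4"
    using assms by linarith
  then show ?thesis
  proof cases
    case 1
    show ?thesis
      by (rule congruence_lift_if_order_four[OF L, of "m2 0 (-1) 1 0"])
        (simp_all add: 1 m2_in_Gamma1 mat_1_m2)
  next
    case 2
    show ?thesis
      by (rule congruence_lift_if_order_four[OF L, of "m2 1 (-1) 2 (-1)"])
        (simp_all add: 2 m2_in_Gamma1 mat_1_m2 cong_def)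
  qed (use L congruence_lift_level_3 congruence_lift_level_4 in auto)
qed

subsection \<open>Cocycles from almost invariant sets\<close>

text \<open>The symmetric difference of \<open>P\<close> and a right translate of it;
  \<open>P\<close> is almost invariant when all these sets are finite.\<close>

definition (in group) crossings :: "('a \<Rightarrow> bool) \<Rightarrow> 'a \<Rightarrow> 'a set" where
  "crossings P g = {x \<in> carrier G. P x \<noteq> P (x \<otimes> g)}"

text \<open>A change of \<open>P\<close> between x and x g h occurs on the way to x g or after it.
  Hence finiteness need only be tested on generators.\<close>

lemma (in group) subgroup_finite_crossings:
  "subgroup {g \<in> carrier G. finite (crossings P g)} G"
proof (rule subgroupI)
  have "crossings P \<one> = {}"
    by (auto simp: crossings_def)
  then show "{g \<in> carrier G. finite (crossings P g)} \<noteq> {}"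
    by force
next
  fix g assume g: "g \<in> {g \<in> carrier G. finite (crossings P g)}"
  have "crossings P (inv g) \<subseteq> (\<lambda>x. x \<otimes> g) ` crossings P g"
  proof
    fix x assume "x \<in> crossings P (inv g)"
    then show "x \<in> (\<lambda>x. x \<otimes> g) ` crossings P g"
      using g by (intro image_eqI[of _ _ "x \<otimes> inv g"]) (auto simp: crossings_def m_assoc)
  qed
  with g show "inv g \<in> {g \<in> carrier G. finite (crossings P g)}"
    by (auto intro: finite_subset)
next
  fix g h assume gh: "g \<in> {g \<in> carrier G. finite (crossings P g)}" "h \<in> {g \<in> carrier G. finite (crossings P g)}"
  have "crossings P (g \<otimes> h) \<subseteq> crossings P g \<union> (\<lambda>x. x \<otimes> inv g) ` crossings P h"
  proof
    fix x assume x: "x \<in> crossings P (g \<otimes> h)"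
    show "x \<in> crossings P g \<union> (\<lambda>x. x \<otimes> inv g) ` crossings P h"
    proof (cases "x \<in> crossings P g")
      case False
      then show ?thesis
        using x gh by (intro UnI2 image_eqI[of _ _ "x \<otimes> g"]) (auto simp: crossings_def m_assoc)
    qed auto
  qed
  with gh show "g \<otimes> h \<in> {g \<in> carrier G. finite (crossings P g)}"
    by (auto intro: finite_subset)
qed auto

lemma odd_card_symm_diff:
  assumes "finite A" "finite B"
  shows "odd (card ((A - B) \<union> (B - A))) \<longleftrightarrow> (odd (card A) \<noteq> odd (card B))"
proof -
  have "card ((A - B) \<union> (B - A)) = card (A - B) + card (B - A)"
    using assms by (intro card_Un_disjoint) auto
  moreover have "card A = card (A - B) + card (A \<inter> B)" "card B = card (B - A) + card (A \<inter> B)"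
    using assms card_Int_Diff[of A B] card_Int_Diff[of B A] by (simp_all add: Int_commute)
  ultimately show ?thesis
    by auto
qed

text \<open>The crossings of g h are the symmetric difference of those of g and a translate of those
  of h. Counting modulo 2 inside \<open>F\<close> gives a cocycle, which is a homomorphism on the
  stabiliser of \<open>F\<close>.\<close>

lemma (in group) odd_card_crossings_mult:
  assumes gh: "g \<in> carrier G" "h \<in> carrier G" and F: "F \<subseteq> carrier G"
    and fin: "finite (crossings P g)" "finite (crossings P h)"
  shows "odd (card (F \<inter> crossings P (g \<otimes> h))) \<longleftrightarrow>
    (odd (card (F \<inter> crossings P g)) \<noteq> odd (card ((F #> g) \<inter> crossings P h)))"
proof -
  define B where "B = {x \<in> F. P (x \<otimes> g) \<noteq> P (x \<otimes> g \<otimes> h)}"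
  have inj: "inj_on (\<lambda>x. x \<otimes> g) B"
    using F gh by (auto simp: B_def inj_on_def subset_iff)
  have im: "(\<lambda>x. x \<otimes> g) ` B = (F #> g) \<inter> crossings P h"
    using F gh by (auto simp: B_def crossings_def r_coset_def image_iff)
  have "finite B"
    using finite_imageD[OF _ inj] im fin by simp
  moreover have "F \<inter> crossings P (g \<otimes> h) = (F \<inter> crossings P g - B) \<union> (B - F \<inter> crossings P g)"
    using F gh by (auto simp: B_def crossings_def m_assoc)
  moreover have "card B = card ((F #> g) \<inter> crossings P h)"
    using card_image[OF inj] im by simp
  ultimately show ?thesis
    using fin by (simp add: odd_card_symm_diff)
qed

subsection \<open>Crossings of the Farey tessellation\<close>

text \<open>\<open>side A\<close> says that the ideal triangle with vertices \<open>A \<infinity>\<close>, \<open>A 0\<close>, \<open>A 1\<close> lies on the positive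
  side of the geodesic from \<open>0\<close> to \<open>\<infinity>\<close>.\<close>

definition side :: "int ^ 2 ^ 2 \<Rightarrow> bool" where
  "side A \<longleftrightarrow> A $ 1 $ 1 * A $ 2 $ 1 \<ge> 0 \<and> A $ 1 $ 2 * A $ 2 $ 2 \<ge> 0 \<and>
     (A $ 1 $ 1 + A $ 1 $ 2) * (A $ 2 $ 1 + A $ 2 $ 2) \<ge> 0"

text \<open>The second matrix is A S with S = \<open>m2 0 (-1) 1 0\<close>. The triangles of A and A
  S are neighbours along the edge from A 0 to A \<infinity>, so the geodesic from 0 to \<infinity>
  separates them only if it is that edge.\<close>

lemma side_flip:
  assumes det: "p * s - q * r = 1"
  shows "side (m2 p q r s) \<noteq> side (m2 q (-p) s (-r)) \<longleftrightarrow>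
    m2 p q r s \<in> {m2 1 0 0 1, m2 (-1) 0 0 (-1), m2 0 (-1) 1 0, m2 0 1 (-1) 0}"
proof -
  \<comment> \<open>\<open>u\<close> and \<open>v\<close> belong to the two shared vertices; the
    third vertices contribute u + v + (2x + 1) and u + v - (2x + 1).\<close>
  define u v x where "u = p * r" and "v = q * s" and "x = q * r"
  have ps: "p * s = 1 + x"
    using det by (simp add: x_def)
  have uv: "u * v = x * (1 + x)"
    using arg_cong[OF ps, of "\<lambda>t. t * x"] by (simp add: u_def v_def x_def algebra_simps)
  have s1: "side (m2 p q r s) \<longleftrightarrow> u \<ge> 0 \<and> v \<ge> 0 \<and> u + v + (2 * x + 1) \<ge> 0"
    using ps by (auto simp: side_def u_def v_def x_def algebra_simps)
  have s2: "side (m2 q (-p) s (-r)) \<longleftrightarrow> u \<ge> 0 \<and> v \<ge> 0 \<and> u + v - (2 * x + 1) \<ge> 0"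
    using ps by (auto simp: side_def u_def v_def x_def algebra_simps)
  consider "x = 0" | "x = -1" | "x \<ge> 1 \<or> x \<le> -2"
    by linarith
  then show ?thesis
  proof cases
    case 1
    then have "p = 1 \<and> s = 1 \<or> p = -1 \<and> s = -1" "q = 0 \<or> r = 0"
      using ps by (auto simp: zmult_eq_1_iff x_def)
    then show ?thesis
      unfolding s1 s2 by (elim disjE conjE; simp add: 1 u_def v_def; presburger)
  next
    case 2
    then have "(- q) * r = 1" "p = 0 \<or> s = 0"
      using ps by (auto simp: x_def)
    then have "- q = 1 \<and> r = 1 \<or> - q = -1 \<and> r = -1" "p = 0 \<or> s = 0"
      using zmult_eq_1_iff by blast+
    then show ?thesis
      unfolding s1 s2 by (elim disjE conjE; simp add: 2 u_def v_def; presburger)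
  next
    case 3
    \<comment> \<open>Here 4uv = (2x + 1)^2 - 1, so (u + v)^2 >= 4uv is too large for u + v to be
      below |2x + 1|.\<close>
    have "\<bar>2 * x + 1\<bar> \<le> u + v" if "u \<ge> 0" "v \<ge> 0"
    proof (rule ccontr)
      assume "\<not> \<bar>2 * x + 1\<bar> \<le> u + v"
      then have "u + v \<le> \<bar>2 * x + 1\<bar> - 1"
        by simp
      then have "(u + v)\<^sup>2 \<le> (\<bar>2 * x + 1\<bar> - 1)\<^sup>2"
        using that by (intro power_mono) auto
      also have "\<dots> = 4 * (x * (1 + x)) + 2 - 2 * \<bar>2 * x + 1\<bar>"
        by (simp add: power2_diff) (simp add: power2_eq_square algebra_simps)
      also have "\<dots> < 4 * (u * v)"
        using 3 uv by arith
      also have "\<dots> \<le> (u + v)\<^sup>2"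
        using zero_le_power2[of "u - v"] by (simp add: power2_eq_square algebra_simps)
      finally show False by simp
    qed
    moreover have "\<not> m2 p q r s \<in> {m2 1 0 0 1, m2 (-1) 0 0 (-1), m2 0 (-1) 1 0, m2 0 1 (-1) 0}"
      using 3 by (auto simp: x_def)
    moreover have "side (m2 p q r s) = side (m2 q (-p) s (-r))" if "u \<ge> 0 \<and> v \<ge> 0 \<longrightarrow> \<bar>2 * x + 1\<bar> \<le> u + v"
      unfolding s1 s2 using that by (cases "u \<ge> 0 \<and> v \<ge> 0") (auto simp: abs_le_iff)
    ultimately show ?thesis
      by blast
  qed
qed

lemma crossings_up:
  "SL2Z.crossings side (up 1) = {m2 1 (-1) 0 1, m2 (-1) 1 0 (-1), m2 0 (-1) 1 (-1), m2 0 1 (-1) 1}"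
proof (rule Set.set_eqI)
  fix A
  show "A \<in> SL2Z.crossings side (up 1) \<longleftrightarrow>
    A \<in> {m2 1 (-1) 0 1, m2 (-1) 1 0 (-1), m2 0 (-1) 1 (-1), m2 0 1 (-1) 1}"
  proof (cases "A \<in> carrier SL2Z")
    case True
    then obtain p q r s where A: "A = m2 p q r s" and det: "p * s - q * r = 1"
      by (rule SL2Z_cases)
    \<comment> \<open>Both matrices describe the same triangle with its vertices rotated. The
      right-hand one is (A \<open>up 1\<close>) S, so \<open>side_flip\<close> applies to A
      \<open>up 1\<close>.\<close>
    have flip: "side (m2 p q r s) = side (m2 (p + q) (- p) (r + s) (- r))"
      by (auto simp: side_def)
    have det': "p * (r + s) - (p + q) * r = 1"
      using det by (simp add: algebra_simps)
    have "A \<in> SL2Z.crossings side (up 1) \<longleftrightarrow>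
        side (m2 p (p + q) r (r + s)) \<noteq> side (m2 (p + q) (- p) (r + s) (- r))"
      using True by (simp add: SL2Z.crossings_def A flip) blast
    also have "\<dots> \<longleftrightarrow> m2 p (p + q) r (r + s) \<in> {m2 1 0 0 1, m2 (-1) 0 0 (-1), m2 0 (-1) 1 0, m2 0 1 (-1) 0}"
      by (rule side_flip[OF det'])
    also have "\<dots> \<longleftrightarrow> A \<in> {m2 1 (-1) 0 1, m2 (-1) 1 0 (-1), m2 0 (-1) 1 (-1), m2 0 1 (-1) 1}"
      unfolding A insert_iff empty_iff m2_eq_iff by presburger
    finally show ?thesis .
  qed (auto simp: SL2Z.crossings_def)
qed

lemma SL2Z_generated:
  assumes K: "subgroup K SL2Z" and up1: "up 1 \<in> K" and S: "m2 0 (-1) 1 0 \<in> K"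
  shows "K = carrier SL2Z"
proof -
  have "a * d - b * c = 1 \<longrightarrow> m2 a b c d \<in> K" for a b c d
  proof (induction "nat \<bar>c\<bar>" arbitrary: a b c d rule: less_induct)
    case less
    show ?case
    proof
      assume det: "a * d - b * c = 1"
      show "m2 a b c d \<in> K"
      proof (cases "c = 0")
        case True
        then have "a = 1 \<and> d = 1 \<or> a = -1 \<and> d = -1"
          using det by (auto simp: zmult_eq_1_iff)
        then show ?thesis
          using True subgroup_up[OF K up1, of b] subgroup_up[OF K up1, of "-b"]
            subgroup_mult[OF K subgroup_mult[OF K S S], of "up (-b)"] by auto
      next
        case False
        define k where "k = - (d div c)"
        have "\<bar>d mod c\<bar> < \<bar>c\<bar>"
          using False by (rule abs_mod_less)
        then have "nat \<bar>k * c + d\<bar> < nat \<bar>c\<bar>"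
          using False by (simp add: k_def minus_mult_div_eq_mod[symmetric] algebra_simps)
        from less[rule_format, OF this, of "k * a + b" "- c" "- a"]
        have "m2 (k * a + b) (- a) (k * c + d) (- c) \<in> K"
          using det by (simp add: algebra_simps)
        from subgroup_div[OF K subgroup_div[OF K this S] subgroup_up[OF K up1, of k]]
        show ?thesis
          by simp
      qed
    qed
  qed
  then have "carrier SL2Z \<subseteq> K"
    using SL2Z_cases by (metis subsetI)
  with K show ?thesis
    using subgroup.subset by blast
qed

text \<open>The generators \<open>up 1\<close> and \<open>m2 0 (-1) 1 0\<close> have at most four
  crossings each.\<close>

lemma finite_crossings_side:
  assumes "g \<in> carrier SL2Z"
  shows "finite (SL2Z.crossings side g)"
proof -
  define K where "K = {g \<in> carrier SL2Z. finite (SL2Z.crossings side g)}"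
  have "SL2Z.crossings side (m2 0 (-1) 1 0) \<subseteq> {m2 1 0 0 1, m2 (-1) 0 0 (-1), m2 0 (-1) 1 0, m2 0 1 (-1) 0}"
  proof
    fix A assume A: "A \<in> SL2Z.crossings side (m2 0 (-1) 1 0)"
    then obtain p q r s where "A = m2 p q r s" "p * s - q * r = 1"
      using SL2Z_cases by (metis (no_types, lifting) SL2Z.crossings_def mem_Collect_eq)
    with A show "A \<in> {m2 1 0 0 1, m2 (-1) 0 0 (-1), m2 0 (-1) 1 0, m2 0 1 (-1) 0}"
      using side_flip[of p s q r] by (simp add: SL2Z.crossings_def)
  qed
  then have "m2 0 (-1) 1 0 \<in> K"
    by (auto simp: K_def intro: finite_subset)
  moreover have "up 1 \<in> K"
    by (simp add: K_def crossings_up)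
  ultimately have "K = carrier SL2Z"
    unfolding K_def by (intro SL2Z_generated SL2Z.subgroup_finite_crossings)
  with assms show ?thesis
    by (auto simp: K_def)
qed

subsection \<open>A non-congruence sign character\<close>

text \<open>For any \<open>g\<close> with bottom row \<open>(c, d)\<close>, the condition says that the first column of \<open>A g\<^sup>-\<^sup>1\<close>
  is \<open>(1, 2)\<close> modulo \<open>N\<close>.\<close>

definition marked :: "nat \<Rightarrow> int \<Rightarrow> int \<Rightarrow> (int ^ 2 ^ 2) set" where
  "marked N c d = {A \<in> carrier SL2Z. [d * A $ 1 $ 1 - c * A $ 1 $ 2 = 1] (mod int N) \<and>
     [d * A $ 2 $ 1 - c * A $ 2 $ 2 = 2] (mod int N)}"

text \<open>A matrix A stands for the edge with ends A^-1 0 and A^-1 \<infinity>;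
  \<open>side\<close> changes from A to A g when this edge separates the base triangle from its
  image under g. The character is the case (c, d) = (0, 1); the other rows index translates of the
  marking.\<close>

definition crossing_parity :: "nat \<Rightarrow> int \<Rightarrow> int \<Rightarrow> int ^ 2 ^ 2 \<Rightarrow> bool" where
  "crossing_parity N c d g \<longleftrightarrow> odd (card (marked N c d \<inter> SL2Z.crossings side g))"

text \<open>If g has bottom row (c, d), the new indices are the bottom row of g times the given
  matrix.\<close>

lemma marked_rcoset:
  assumes det: "a' * d' - b' * c' = 1"
  shows "marked N c d #>\<^bsub>SL2Z\<^esub> m2 a' b' c' d' = marked N (c * a' + d * c') (c * b' + d * d')"
proof -
  let ?g = "m2 a' b' c' d'" and ?M = "marked N (c * a' + d * c') (c * b' + d * d')"
  have g: "?g \<in> carrier SL2Z"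
    using det by simp
  have row: "(c * b' + d * d') * (x * a' + y * c') - (c * a' + d * c') * (x * b' + y * d') = d * x - c * y" for x y
  proof -
    have "(c * b' + d * d') * (x * a' + y * c') - (c * a' + d * c') * (x * b' + y * d')
      = (a' * d' - b' * c') * (d * x - c * y)"
      by (simp add: algebra_simps)
    then show ?thesis by (simp add: det)
  qed
  have iff: "A ** ?g \<in> ?M \<longleftrightarrow> A \<in> marked N c d" if "A \<in> carrier SL2Z" for A
  proof -
    have "A ** ?g \<in> carrier SL2Z"
      using SL2Z.m_closed[OF that g] by simp
    moreover from that obtain p q r s where "A = m2 p q r s"
      by (rule SL2Z_cases)
    ultimately show ?thesis
      using that by (simp add: marked_def row)
  qed
  show ?thesis
  proof (intro equalityI subsetI)
    fix B assume "B \<in> marked N c d #>\<^bsub>SL2Z\<^esub> ?g"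
    then obtain A where "A \<in> marked N c d" "B = A ** ?g"
      by (auto simp: r_coset_def)
    with iff[of A] show "B \<in> ?M"
      by (simp add: marked_def)
  next
    fix B assume B: "B \<in> ?M"
    then have Bc: "B \<in> carrier SL2Z"
      by (simp add: marked_def)
    define A where "A = B \<otimes>\<^bsub>SL2Z\<^esub> inv\<^bsub>SL2Z\<^esub> ?g"
    have "A \<otimes>\<^bsub>SL2Z\<^esub> ?g = B" "A \<in> carrier SL2Z"
      using Bc g by (auto simp: A_def SL2Z.m_assoc simp del: mult_SL2Z one_SL2Z m2_in_SL2Z)
    then show "B \<in> marked N c d #>\<^bsub>SL2Z\<^esub> ?g"
      using iff[of A] B by (auto simp: r_coset_def)
  qed
qed

lemma crossing_parity_mult:
  assumes g: "a' * d' - b' * c' = 1" and h: "h \<in> carrier SL2Z"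
  shows "crossing_parity N c d (m2 a' b' c' d' ** h) \<longleftrightarrow>
    (crossing_parity N c d (m2 a' b' c' d') \<noteq> crossing_parity N (c * a' + d * c') (c * b' + d * d') h)"
proof -
  have "m2 a' b' c' d' \<in> carrier SL2Z" "marked N c d \<subseteq> carrier SL2Z"
    using g by (auto simp: marked_def)
  then show ?thesis
    using SL2Z.odd_card_crossings_mult[of "m2 a' b' c' d'" h "marked N c d" side] h finite_crossings_side
    by (simp add: crossing_parity_def marked_rcoset[OF g])
qed

lemma crossing_parity_one [simp]: "\<not> crossing_parity N c d (m2 1 0 0 1)"
proof -
  have "SL2Z.crossings side (m2 1 0 0 1) = {}"
    using SL2Z.r_one by (auto simp: SL2Z.crossings_def)
  then show ?thesis
    by (simp add: crossing_parity_def)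
qed

lemma crossing_parity_cong:
  assumes c: "[c = c'] (mod int N)" and d: "[d = d'] (mod int N)"
  shows "crossing_parity N c d = crossing_parity N c' d'"
proof -
  have "[d * x - c * y = d' * x - c' * y] (mod int N)" for x y
    using c d by (intro cong_diff cong_mult) auto
  then have "[d * x - c * y = z] (mod int N) \<longleftrightarrow> [d' * x - c' * y = z] (mod int N)" for x y z
    using cong_trans cong_sym by blast
  then show ?thesis
    by (simp add: crossing_parity_def marked_def fun_eq_iff)
qed

text \<open>Bottom rows in \<open>Gamma1 N\<close> are (0, 1) modulo \<open>N\<close>, so these
  elements preserve the marking and the cocycle becomes a character.\<close>

lemma crossing_parity_hom:
  assumes "A \<in> Gamma1 N" "B \<in> Gamma1 N"
  shows "crossing_parity N 0 1 (A ** B) \<longleftrightarrow> (crossing_parity N 0 1 A \<noteq> crossing_parity N 0 1 B)"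
proof -
  obtain a b c d where A: "A = m2 a b c d" "a * d - b * c = 1"
    using assms Gamma1_carrier SL2Z_cases by metis
  have "crossing_parity N c d = crossing_parity N 0 1"
    using assms(1) by (intro crossing_parity_cong) (auto simp: A m2_in_Gamma1)
  then show ?thesis
    using crossing_parity_mult[OF A(2) Gamma1_carrier[OF assms(2)], of N 0 1] by (simp add: A)
qed

text \<open>The matrix is g \<open>up K\<close> g^-1 with g = \<open>m2 a b c d\<close>, a parabolic
  element fixing the cusp a/c. Since \<open>up K\<close> changes (c, d) only by a multiple of
  \<open>N\<close>, the contributions of g and g^-1 cancel.\<close>

lemma crossing_parity_conjugate:
  assumes det: "a * d - b * c = 1" and K: "int N dvd K"
  shows "crossing_parity N 0 1 (m2 (1 - K * a * c) (K * a * a) (- K * c * c) (1 + K * a * c)) =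
    crossing_parity N c d (up K)"
proof -
  let ?g = "m2 a b c d" and ?g' = "m2 d (-b) (-c) a"
  have g': "?g' \<in> carrier SL2Z" "up K ** ?g' \<in> carrier SL2Z"
    using det by (simp_all add: algebra_simps)
  have "[c * K + d = 0 + d] (mod int N)"
    using K by (intro cong_add) (auto simp: cong_0_iff)
  then have shift: "crossing_parity N c (c * K + d) = crossing_parity N c d"
    by (intro crossing_parity_cong) auto
  have "?g ** (up K ** ?g') = m2 (1 - K * a * c) (K * a * a) (- K * c * c) (1 + K * a * c)"
    using det by (simp add: algebra_simps)
  moreover have "crossing_parity N 0 1 (?g ** (up K ** ?g')) \<longleftrightarrow>
      (crossing_parity N 0 1 ?g \<noteq> (crossing_parity N c d (up K) \<noteq> crossing_parity N c d ?g'))"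
    using crossing_parity_mult[OF det g'(2), of N 0 1]
      crossing_parity_mult[of 1 1 K 0 ?g' N c d] g'(1) shift by simp
  moreover have "?g ** ?g' = m2 1 0 0 1"
    using det by (simp add: algebra_simps)
  then have "crossing_parity N 0 1 ?g = crossing_parity N c d ?g'"
    using crossing_parity_mult[OF det g'(1), of N 0 1] by simp
  ultimately show ?thesis
    by metis
qed

section \<open>Counting marked crossings along powers of \<open>up 1\<close>\<close>

lemma crossing_parity_up_Suc:
  "crossing_parity N c d (up (int (Suc n))) \<longleftrightarrow>
    (crossing_parity N c d (up 1) \<noteq> crossing_parity N c (c + d) (up (int n)))"
  using crossing_parity_mult[of 1 1 1 0 "up (int n)" N c d] by (simp add: add.commute)

text \<open>Of the four crossings of \<open>up 1\<close>, the upper triangular ones can be marked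
  only if \<open>c\<close> is 2 or -2 modulo \<open>N\<close>. The other two are negatives of each
  other and give the two conditions.\<close>

lemma crossing_parity_up_1:
  assumes "\<not> [c = 2] (mod int N)" "\<not> [c = - 2] (mod int N)"
  shows "crossing_parity N c d (up 1) \<longleftrightarrow>
    ([c = 1] (mod int N) \<and> [c + d = 2] (mod int N)) \<noteq> ([c = - 1] (mod int N) \<and> [c + d = - 2] (mod int N))"
proof -
  let ?A = "m2 0 (-1) 1 (-1)" and ?B = "m2 0 1 (-1) 1"
  have A: "?A \<in> marked N c d \<longleftrightarrow> [c = 1] (mod int N) \<and> [c + d = 2] (mod int N)"
    by (simp add: marked_def add.commute)
  have "[- c = 1] (mod int N) \<longleftrightarrow> [c = - 1] (mod int N)" "[- d - c = 2] (mod int N) \<longleftrightarrow> [c + d = - 2] (mod int N)"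
    "[- c = 2] (mod int N) \<longleftrightarrow> [c = - 2] (mod int N)"
    using cong_minus_minus_iff[of "-c" 1 "int N"] cong_minus_minus_iff[of "-d-c" 2 "int N"]
      cong_minus_minus_iff[of "-c" 2 "int N"] by (simp_all add: add.commute)
  note neg = this
  have B: "?B \<in> marked N c d \<longleftrightarrow> [c = - 1] (mod int N) \<and> [c + d = - 2] (mod int N)"
    using neg by (simp add: marked_def)
  have "m2 1 (-1) 0 1 \<notin> marked N c d" "m2 (-1) 1 0 (-1) \<notin> marked N c d"
    using assms neg by (auto simp: marked_def)
  then have "marked N c d \<inter> SL2Z.crossings side (up 1) = (if ?A \<in> marked N c d then {?A} else {}) \<union> (if ?B \<in> marked N c d then {?B} else {})"
    unfolding crossings_up by auto
  then show ?thesis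
    unfolding crossing_parity_def A B by auto
qed

lemma crossing_parity_up_unmarked:
  assumes "\<not> [c = 1] (mod int N)" "\<not> [c = - 1] (mod int N)" "\<not> [c = 2] (mod int N)" "\<not> [c = - 2] (mod int N)"
  shows "\<not> crossing_parity N c d (up (int n))"
proof (induction n arbitrary: d)
  case (Suc n)
  then show ?case
    using assms crossing_parity_up_1[of c N d] by (simp only: crossing_parity_up_Suc) simp
qed simp

text \<open>In a period of \<open>N\<close> steps the second index runs from 1 to \<open>N\<close>,
  and only the step at 1 is marked, so each period contributes one crossing.\<close>

lemma crossing_parity_up_marked:
  assumes N: "N \<ge> 5"
  shows "crossing_parity N 1 1 (up (int N * int j)) \<longleftrightarrow> odd j"
proof -
  have small: "\<not> [x = y] (mod int N)" if "x \<noteq> y" "\<bar>x - y\<bar> < int N" for x y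
    using that zdvd_imp_le[of "int N" "\<bar>x - y\<bar>"] by (auto simp: cong_iff_dvd_diff)
  have step: "crossing_parity N 1 d (up 1) \<longleftrightarrow> [1 + d = 2] (mod int N)" for d
    using crossing_parity_up_1[of 1 N d] N small by auto
  \<comment> \<open>The steps use the indices d, ..., d + n - 1, which stop at \<open>N\<close>; the
    next one, \<open>N + 1\<close>, would be marked again.\<close>
  have gap: "\<not> crossing_parity N 1 d (up (int n))" if "d \<ge> 2" "d + int n \<le> int N + 1" for d n
    using that
  proof (induction n arbitrary: d)
    case (Suc n)
    have "\<not> crossing_parity N 1 d (up 1)"
      using small[of "1 + d" 2] Suc.prems by (simp add: step)
    moreover have "\<not> crossing_parity N 1 (1 + d) (up (int n))"
      using Suc.prems by (intro Suc.IH) auto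
    ultimately show ?case
      by (simp only: crossing_parity_up_Suc)
  qed simp
  obtain n where n: "N = Suc n"
    using N by (cases N) auto
  have period: "crossing_parity N 1 1 (up (int N))"
    using crossing_parity_up_Suc[of N 1 1 n] gap[of 2 n] step[of 1] by (simp add: n)
  have shift: "crossing_parity N 1 (int N + 1) = crossing_parity N 1 1"
    by (intro crossing_parity_cong) (auto simp: cong_def)
  show ?thesis
  proof (induction j)
    case (Suc j)
    then show ?case
      using crossing_parity_mult[of 1 1 "int N" 0 "up (int N * int j)" N 1 1] period shift
      by (simp add: algebra_simps)
  qed simp
qed

lemma m2_in_Gamma1_bottom:
  assumes "a * d - b * c = 1"
  shows "m2 a b c d \<in> Gamma1 N \<longleftrightarrow> [c = 0] (mod int N) \<and> [d = 1] (mod int N)"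
proof -
  have "[a = 1] (mod int N)" if c: "[c = 0] (mod int N)" and d: "[d = 1] (mod int N)"
  proof -
    have "[a * 1 - b * 0 = a * d - b * c] (mod int N)"
      using c d by (intro cong_diff cong_mult) (auto simp: cong_sym)
    then show ?thesis
      using assms by simp
  qed
  then show ?thesis
    using assms by (auto simp: m2_in_Gamma1)
qed

section \<open>The lift obtained by twisting with a sign character\<close>

definition sign_twist :: "nat \<Rightarrow> (int ^ 2 ^ 2 \<Rightarrow> bool) \<Rightarrow> (int ^ 2 ^ 2) set" where
  "sign_twist N \<epsilon> = {A \<in> carrier SL2Z. A \<in> Gamma1 N \<and> \<not> \<epsilon> A \<or> - A \<in> Gamma1 N \<and> \<epsilon> (- A)}"

lemma subgroup_sign_twist:
  assumes hom: "\<And>A B. A \<in> Gamma1 N \<Longrightarrow> B \<in> Gamma1 N \<Longrightarrow> \<epsilon> (A ** B) = (\<epsilon> A \<noteq> \<epsilon> B)"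
  shows "subgroup (sign_twist N \<epsilon>) SL2Z"
proof (rule SL2Z.subgroupI)
  have one: "m2 1 0 0 1 \<in> Gamma1 N"
    by (simp add: m2_in_Gamma1)
  have \<epsilon>1: "\<not> \<epsilon> (m2 1 0 0 1)"
    using hom[OF one one] by simp
  show "sign_twist N \<epsilon> \<subseteq> carrier SL2Z"
    by (auto simp: sign_twist_def)
  show "sign_twist N \<epsilon> \<noteq> {}"
    using one \<epsilon>1 by (force simp: sign_twist_def)
  have inv: "inv\<^bsub>SL2Z\<^esub> A \<in> Gamma1 N \<and> \<epsilon> (inv\<^bsub>SL2Z\<^esub> A) = \<epsilon> A" if A: "A \<in> Gamma1 N" for A
  proof -
    have i: "inv\<^bsub>SL2Z\<^esub> A \<in> Gamma1 N"
      by (rule subgroup.m_inv_closed[OF subgroup_Gamma1 A])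
    have "A ** inv\<^bsub>SL2Z\<^esub> A = m2 1 0 0 1"
      using SL2Z.r_inv[OF Gamma1_carrier[OF A]] by simp
    then show ?thesis
      using hom[OF A i] \<epsilon>1 i by simp
  qed
  fix A assume A: "A \<in> sign_twist N \<epsilon>"
  then have Ac: "A \<in> carrier SL2Z"
    by (simp add: sign_twist_def)
  show "inv\<^bsub>SL2Z\<^esub> A \<in> sign_twist N \<epsilon>"
    using A Ac inv[of A] inv[of "- A"] inv_neg[OF Ac] by (auto simp: sign_twist_def)
  fix B assume B: "B \<in> sign_twist N \<epsilon>"
  have "A ** B \<in> carrier SL2Z"
    using Ac B SL2Z.m_closed[of A B] by (simp add: sign_twist_def)
  then show "A \<otimes>\<^bsub>SL2Z\<^esub> B \<in> sign_twist N \<epsilon>"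
    using A B hom[of A B] hom[of "-A" B] hom[of A "-B"] hom[of "-A" "-B"]
      subgroup_mult[OF subgroup_Gamma1, of A N B] subgroup_mult[OF subgroup_Gamma1, of "-A" N B]
      subgroup_mult[OF subgroup_Gamma1, of A N "-B"] subgroup_mult[OF subgroup_Gamma1, of "-A" N "-B"]
    by (auto simp: sign_twist_def neg_mult_left neg_mult_right)
qed

text \<open>Projection forgets signs, which gives the image. For finite index, the bottom row modulo
  \<open>N\<close> determines the coset of \<open>Gamma1 N\<close>, and each such coset is covered
  by two cosets of the twist, those of a representative and its negative.\<close>

lemma is_lift_sign_twist:
  assumes hom: "\<And>A B. A \<in> Gamma1 N \<Longrightarrow> B \<in> Gamma1 N \<Longrightarrow> \<epsilon> (A ** B) = (\<epsilon> A \<noteq> \<epsilon> B)" and N: "N \<ge> 1"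
  shows "is_lift (sign_twist N \<epsilon>) (proj_PSL2Z ` Gamma1 N)"
proof -
  define H where "H = sign_twist N \<epsilon>"
  have H: "subgroup H SL2Z"
    unfolding H_def using hom by (rule subgroup_sign_twist)
  have pm: "A \<in> H \<or> - A \<in> H" if "A \<in> Gamma1 N" for A
    using that Gamma1_carrier[OF that] by (auto simp: H_def sign_twist_def)
  have proj_neg: "proj_PSL2Z (- A) = proj_PSL2Z A" for A
    by (auto simp: proj_PSL2Z_eq)
  have proj: "proj_PSL2Z ` H = proj_PSL2Z ` Gamma1 N"
  proof
    show "proj_PSL2Z ` H \<subseteq> proj_PSL2Z ` Gamma1 N"
    proof
      fix C assume "C \<in> proj_PSL2Z ` H"
      then obtain A where "C = proj_PSL2Z A" "A \<in> Gamma1 N \<or> - A \<in> Gamma1 N"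
        by (auto simp: H_def sign_twist_def)
      then show "C \<in> proj_PSL2Z ` Gamma1 N"
        using proj_neg[of A] by auto
    qed
    show "proj_PSL2Z ` Gamma1 N \<subseteq> proj_PSL2Z ` H"
    proof
      fix C assume "C \<in> proj_PSL2Z ` Gamma1 N"
      then obtain A where "C = proj_PSL2Z A" "A \<in> H \<or> - A \<in> H"
        using pm by auto
      then show "C \<in> proj_PSL2Z ` H"
        using proj_neg[of A] by auto
    qed
  qed
  define key where "key A = (A $ 2 $ 1 mod int N, A $ 2 $ 2 mod int N)" for A :: "int ^ 2 ^ 2"
  \<comment> \<open>For a pair that is no bottom row modulo \<open>N\<close> the choice is
    arbitrary; this is harmless, as \<open>rep\<close> is used only at keys of actual
    matrices.\<close>
  define rep where "rep k = (SOME A. A \<in> carrier SL2Z \<and> key A = k)" for k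
  let ?keys = "{0..<int N} \<times> {0..<int N}"
  have "rcosets\<^bsub>SL2Z\<^esub> H \<subseteq> (\<lambda>k. H #>\<^bsub>SL2Z\<^esub> rep k) ` ?keys \<union> (\<lambda>k. H #>\<^bsub>SL2Z\<^esub> (- rep k)) ` ?keys"
  proof
    fix C assume "C \<in> rcosets\<^bsub>SL2Z\<^esub> H"
    then obtain A where A: "A \<in> carrier SL2Z" and C: "C = H #>\<^bsub>SL2Z\<^esub> A"
      by (auto simp: RCOSETS_def)
    define R where "R = rep (key A)"
    have R: "R \<in> carrier SL2Z" "key R = key A"
      using someI[of "\<lambda>B. B \<in> carrier SL2Z \<and> key B = key A" A] A by (auto simp: R_def rep_def)
    have kA: "key A \<in> ?keys"
      using N by (auto simp: key_def)
    obtain a b c d where Ae: "A = m2 a b c d" "a * d - b * c = 1"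
      using A by (rule SL2Z_cases)
    obtain a' b' c' d' where Re: "R = m2 a' b' c' d'" "a' * d' - b' * c' = 1"
      using R(1) by (rule SL2Z_cases)
    have cd: "[c = c'] (mod int N)" "[d = d'] (mod int N)"
      using R(2) by (auto simp: key_def Ae Re cong_def)
    define h where "h = A \<otimes>\<^bsub>SL2Z\<^esub> inv\<^bsub>SL2Z\<^esub> R"
    have hc: "h \<in> carrier SL2Z"
      unfolding h_def by (intro SL2Z.m_closed A SL2Z.inv_closed R(1))
    have hR: "h ** R = A"
      using SL2Z.inv_solve_right[OF hc A R(1)] h_def by simp
    have he: "h = m2 (a * d' - b * c') (- (a * b') + b * a') (c * d' - d * c') (- (c * b') + d * a')"
      by (simp add: h_def Ae(1) Re(1) inv_m2[OF Re(2)])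
    have "[c * d' - d * c' = c' * d' - d' * c'] (mod int N)"
      "[- (c * b') + d * a' = - (c' * b') + d' * a'] (mod int N)"
      using cd by (intro cong_add cong_diff cong_mult cong_minus_minus_iff[THEN iffD2]; simp)+
    moreover have "- (c' * b') + d' * a' = 1" "c' * d' - d' * c' = 0"
      using Re(2) by (simp_all add: algebra_simps)
    ultimately have "h \<in> Gamma1 N"
      using hc unfolding he m2_in_SL2Z by (simp add: m2_in_Gamma1_bottom)
    then consider "h \<in> H" | "- h \<in> H"
      using pm by blast
    then have "C = H #>\<^bsub>SL2Z\<^esub> R \<or> C = H #>\<^bsub>SL2Z\<^esub> (- R)"
    proof cases
      case 1
      then have "A \<in> H #>\<^bsub>SL2Z\<^esub> R"
        using hR by (force simp: r_coset_def)
      then show ?thesis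
        using SL2Z.repr_independence[OF _ R(1) H] C by blast
    next
      case 2
      then have "A \<in> H #>\<^bsub>SL2Z\<^esub> (- R)"
        using hR by (force simp: r_coset_def neg_mult_left neg_mult_right)
      then show ?thesis
        using SL2Z.repr_independence[OF _ _ H, of A "- R"] R(1) C by simp
    qed
    with kA show "C \<in> (\<lambda>k. H #>\<^bsub>SL2Z\<^esub> rep k) ` ?keys \<union> (\<lambda>k. H #>\<^bsub>SL2Z\<^esub> (- rep k)) ` ?keys"
      unfolding R_def by (elim disjE) (simp_all only: Un_iff image_eqI simp_thms)
  qed
  then have "finite (rcosets\<^bsub>SL2Z\<^esub> H)"
    by (rule finite_subset) simp
  with H proj show ?thesis
    by (simp add: is_lift_def H_def)
qed

text \<open>The value 3 fails only for N = 5, where it is -2; there 5 is 0. Oddness makes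
  \<open>c\<close> coprime to the powers of 2 used as numerators and keeps a later exponent
  odd.\<close>

lemma unmarked_cusp:
  assumes N: "N \<ge> 5"
  obtains c :: int where "odd c" "\<not> [c = 1] (mod int N)" "\<not> [c = - 1] (mod int N)"
    "\<not> [c = 2] (mod int N)" "\<not> [c = - 2] (mod int N)"
proof (cases "N = 5")
  case True
  show ?thesis by (rule that[of 5]) (simp_all add: True cong_def)
next
  case False
  then have "int N \<ge> 6"
    using N by simp
  then have "\<not> [3 = x] (mod int N)" if "x \<in> {1, -1, 2, -2}" for x :: int
    using that zdvd_imp_le[of "int N" "3 - x"] by (auto simp: cong_iff_dvd_diff)
  then show ?thesis by (intro that[of 3]) auto
qed

text \<open>Both factors of \<open>Q\<close> are conjugate to powers of \<open>up N\<close>, at cusps with odd denominators \<open>c\<close>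
  and \<open>1\<close>. They agree modulo \<open>M\<close> since the numerator \<open>2 ^ e\<close> of the first cusp kills the entries
  divisible by \<open>m * 2 ^ e\<close>, but only the second one crosses marked edges, an odd number of times.\<close>

lemma crossing_parity_non_congruence:
  assumes N: "N \<ge> 5" and M: "M \<ge> 1"
  shows "\<exists>Q \<in> Gamma M \<inter> Gamma1 N. crossing_parity N 0 1 Q"
proof -
  obtain e m where m: "M = 2 ^ e * m" "odd m"
    by (rule multiplicity_decompose'[of M 2]) (use M in auto)
  obtain c :: int where c: "odd c" "\<not> [c = 1] (mod int N)" "\<not> [c = - 1] (mod int N)"
    "\<not> [c = 2] (mod int N)" "\<not> [c = - 2] (mod int N)"
    using unmarked_cusp[OF N] by metis
  define a :: int where "a = 2 ^ e"
  have "coprime a c"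
    using c(1) by (simp add: a_def)
  then obtain d b' where "a * d + c * b' = 1"
    using bezout_int[of a c] by (metis coprime_imp_gcd_eq_1 mult.commute)
  then obtain b where det: "a * d - b * c = 1"
    by (metis diff_minus_eq_add mult.commute mult_minus_left)
  \<comment> \<open>The factor \<open>N\<close> puts both matrices into \<open>Gamma1 N\<close>; the
    odd part \<open>m\<close> makes \<open>K * a\<close> divisible by \<open>M\<close> while
    \<open>j\<close>, which is m c^2, stays odd.\<close>
  define K where "K = int N * int m"
  define X where "X = m2 (1 - K * a * c) (K * a * a) (- K * c * c) (1 + K * a * c)"
  \<comment> \<open>This exponent gives \<open>Y\<close> the lower left entry of \<open>X\<close>,
    so that the quotient differs from 1 only by multiples of \<open>K * a\<close>.\<close>
  define Y where "Y = lo (- (K * c * c))"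
  have NK: "int N dvd K" "int N dvd K * c * c"
    by (simp_all add: K_def)
  obtain n j where n: "K = int n" and j: "K * c * c = int N * int j" "odd j"
  proof
    show "K = int (N * m)" by (simp add: K_def)
    show "K * c * c = int N * int (m * nat (c * c))"
      by (simp add: K_def)
    show "odd (m * nat (c * c))"
      using m(2) c(1) by (simp add: even_nat_iff)
  qed
  have "\<not> crossing_parity N 0 1 X"
    using crossing_parity_up_unmarked[OF c(2-5), of d n]
    by (simp only: X_def crossing_parity_conjugate[OF det NK(1)] n[symmetric] simp_thms)
  \<comment> \<open>\<open>Y\<close> is the conjugate of \<open>up (K * c * c)\<close> by
    \<open>m2 0 (-1) 1 1\<close>, whose bottom row (1, 1) is the one treated in
    \<open>crossing_parity_up_marked\<close>.\<close>
  moreover have "crossing_parity N 0 1 Y"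
    using crossing_parity_conjugate[of 0 1 "-1" 1 N "K * c * c"] NK(2) crossing_parity_up_marked[OF N, of j] j
    by (simp add: Y_def)
  moreover have XY: "X \<in> Gamma1 N" "inv\<^bsub>SL2Z\<^esub> Y \<in> Gamma1 N" "Y \<in> Gamma1 N"
    using NK by (auto simp: X_def Y_def inv_m2 m2_in_Gamma1_bottom cong_iff_dvd_diff algebra_simps)
  moreover have "Y ** inv\<^bsub>SL2Z\<^esub> Y = m2 1 0 0 1"
    by (simp add: Y_def inv_m2)
  then have "crossing_parity N 0 1 (inv\<^bsub>SL2Z\<^esub> Y) = crossing_parity N 0 1 Y"
    using crossing_parity_hom[OF XY(3,2)] by simp
  ultimately have "crossing_parity N 0 1 (X ** inv\<^bsub>SL2Z\<^esub> Y)"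
    using crossing_parity_hom by simp
  moreover have "X ** inv\<^bsub>SL2Z\<^esub> Y \<in> Gamma1 N"
    using subgroup_mult[OF subgroup_Gamma1] XY by simp
  moreover have "X ** inv\<^bsub>SL2Z\<^esub> Y \<in> Gamma M"
  proof -
    have Ka: "int M dvd K * a"
      by (simp add: K_def a_def m(1))
    have "X ** inv\<^bsub>SL2Z\<^esub> Y = m2 (1 + K * a * (K * a * c * c - c)) (K * a * a) (K * a * (K * c * c * c)) (1 + K * a * c)"
      by (simp add: X_def Y_def inv_m2 algebra_simps)
    moreover have "X ** inv\<^bsub>SL2Z\<^esub> Y \<in> carrier SL2Z"
      using subgroup_mult[OF subgroup_Gamma1 XY(1,2)] by (rule Gamma1_carrier)
    ultimately show ?thesis
      using Ka by (simp add: m2_in_Gamma cong_iff_dvd_diff)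
  qed
  ultimately show ?thesis
    by blast
qed

theorem theorem3:
  fixes N :: nat
  assumes "N \<ge> 1"
  shows "(\<forall>H. is_lift H (proj_PSL2Z ` Gamma1 N) \<longrightarrow> congruence_subgroup H) \<longleftrightarrow> N \<le> 4"
proof
  assume "N \<le> 4"
  then show "\<forall>H. is_lift H (proj_PSL2Z ` Gamma1 N) \<longrightarrow> congruence_subgroup H"
    using assms congruence_lift_level_le_4 by blast
next
  assume all: "\<forall>H. is_lift H (proj_PSL2Z ` Gamma1 N) \<longrightarrow> congruence_subgroup H"
  show "N \<le> 4"
  proof (rule ccontr)
    assume "\<not> N \<le> 4"
    then have N: "N \<ge> 5" by simp
    let ?H = "sign_twist N (crossing_parity N 0 1)"
    have "congruence_subgroup ?H"
      using all is_lift_sign_twist[of N "crossing_parity N 0 1"] crossing_parity_hom assms by blast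
    then obtain M where M: "M \<ge> 1" "Gamma M \<subseteq> ?H"
      by (auto simp: congruence_subgroup_def)
    obtain Q where Q: "Q \<in> Gamma M" "Q \<in> Gamma1 N" "crossing_parity N 0 1 Q"
      using crossing_parity_non_congruence[OF N M(1)] by blast
    \<comment> \<open>As \<open>Q\<close> has sign -1, it can belong to the twist only through
      \<open>- Q\<close>. Having both in \<open>Gamma1 N\<close> forces \<open>N\<close> to divide
      2.\<close>
    then have "- Q \<in> Gamma1 N"
      using M(2) by (auto simp: sign_twist_def)
    moreover obtain a b c d where "Q = m2 a b c d"
      using Q(2) Gamma1_carrier SL2Z_cases by metis
    ultimately have "[d = 1] (mod int N)" "[- d = 1] (mod int N)"
      using Q(2) by (auto simp: m2_in_Gamma1)
    then have "[d + - d = 1 + 1] (mod int N)"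
      by (rule cong_add)
    then have "int N dvd 2"
      by (simp add: cong_0_iff cong_sym_eq[of 0])
    then show False
      using N zdvd_imp_le[of "int N" 2] by simp
  qed
qed

end
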